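(* Let $u\in C_{c,+}(\mathbb R^3;\mathbb R)$, $T\in C(\mathbb R;\mathbb R^3)$, $R\in C^4(\mathbb R;SO(3))$, let $\omega\in C^3(\mathbb R;\mathbb R^3)$ be the angular velocity corresponding to $R$, with cylindrical radius $\alpha$, cylindrical component $v$, cylindrical angle $\varphi$ and third component $\omega_3$, let $\sigma(t)=\varphi'(t)$, and let $\tilde{\mathcal J}$ be the reduced attenuation map of $u$ under the motion $(T,R)$. Then for all $t\in\mathbb R$ such that $\alpha(t)\neq0$ and $\sigma(t)\neq-\omega_3(t)$, we have $$A_0(\mu)+A_{02}(\mu)\,\alpha(t)^2+A_1(\mu)\,\mu\,\frac{\alpha'(t)}{\alpha(t)}=0\qquad\text{for all }\mu\in\mathbb R,$$ where, with $v,v^\perp,\omega_3,\omega_3',\sigma$ all evaluated at $t$, $$\begin{aligned} A_0(\mu)&=\tfrac14\mu(\omega_3+\sigma)\Big[\mu^2\omega_3(\omega_3-\sigma)\,\mathbf D^3[\tilde{\mathcal J}](t,\mu v)[\![v^\perp,v^\perp,v^\perp]\!]\\ &\qquad+2\mu\,\mathbf D^2[\tilde{\mathcal J}](t,\mu v)[\![v^\perp,\omega_3\sigma v-\omega_3'v^\perp]\!]+2\,\mathbf D^1[\tilde{\mathcal J}](t,\mu v)[\![\omega_3^2v^\perp+\omega_3'v]\!]\\ &\qquad-\mu(3\omega_3-\sigma)\,\partial_t\mathbf D^2[\tilde{\mathcal J}](t,\mu v)[\![v^\perp,v^\perp]\!]+2\,\partial_{tt}\mathbf D^1[\tilde{\mathcal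 J}](t,\mu v)[\![v^\perp]\!]\Big],\\ A_{02}(\mu)&=\tfrac12\mu(\omega_3+\sigma)\,\mathbf D^1[\tilde{\mathcal J}](t,\mu v)[\![v^\perp]\!],\\ A_1(\mu)&=\tfrac12(\omega_3+\sigma)\Big[\mu\omega_3\,\mathbf D^2[\tilde{\mathcal J}](t,\mu v)[\![v^\perp,v^\perp]\!]-\omega_3\,\mathbf D^1[\tilde{\mathcal J}](t,\mu v)[\![v]\!]-\partial_t\mathbf D^1[\tilde{\mathcal J}](t,\mu v)[\![v^\perp]\!]\Big]. \end{aligned}$$
   Context: $C_{c,+}(\mathbb R^3;\mathbb R)=\{u\in C(\mathbb R^3;\mathbb R)\mid \operatorname{supp}(u)\neq\emptyset\text{ is compact},\ u\ge 0\}$. The center of $u$ is $\mathcal C_3:=\frac{1}{\int_{\mathbb R^3}u}\int_{\mathbb R^3}x\,u(x)\,dx$. The attenuation mapping of $u$ under a rigid motion $(T,R)$ is $$\mathcal J[T,R](t,x_1,x_2)=\int_{-\infty}^{\infty}u\big(\mathcal C_3+R(t)(x-\mathcal C_3+T(t))\big)\,dx_3,\qquad x=(x_1,x_2,x_3)^T.$$ Its two-dimensional center is $\mathcal C_2(t):=\frac{1}{\int_{\mathbb R^2}\mathcal J[T,R](t,x)\,dx}\int_{\mathbb R^2}x\,\mathcal J[T,R](t,x)\,dx\in\mathbb R^2$. With the Fourier transform convention $\mathcal F_2[f](k)=(2\pi)^{-1}\int_{\mathbb R^2}f(x)e^{-\mathrm i\langle k,x\rangle}\,dx$ (applied in the variables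 $(x_1,x_2)$), the reduced attenuation map is the (complex-valued) function $$\tilde{\mathcal J}(t,k)=\mathcal F_2[\mathcal J[T,R]](t,k)\,e^{\mathrm i\langle k,\mathcal C_2(t)\rangle},\qquad (t,k)\in\mathbb R\times\mathbb R^2.$$ The angular velocity $\omega$ of $R\in C^1(\mathbb R;SO(3))$ is defined by $R(t)^TR'(t)x=\omega(t)\times x$ for all $x\in\mathbb R^3$. It is written in cylindrical coordinates with axis $e_3$ as $$\omega(t)=\begin{pmatrix}\alpha(t)v(t)\\ \omega_3(t)\end{pmatrix}=\begin{pmatrix}\alpha(t)\cos\varphi(t)\\ \alpha(t)\sin\varphi(t)\\ \omega_3(t)\end{pmatrix},$$ with continuous $\alpha:\mathbb R\to[0,\infty)$ (cylindrical radius), $v:\mathbb R\to\mathbb S^1\subset\mathbb R^2$ (cylindrical component) and $\varphi:\mathbb R\to\mathbb R$ (cylindrical angle); $v^\perp(t)=(-v_2(t),v_1(t))^T$. For $f:\mathbb R\times\mathbb R^2\to\mathbb C$, $\mathbf D^i[f](t,\kappa)[\![w_1,\dots,w_i]\!]$ denotes the $i$-th derivative tensor of $k\mapsto f(t,k)$ (for fixed $t$) at the point $\kappa\in\mathbb R^2$, evaluated at the vectors $w_1,\dots,w_i\in\mathbb R^2$. The symbols $\partial_t\mathbf D^i[f](t,\kappa)[\![w_1,\dots,w_i]\!]$ and $\partial_{tt}\mathbf D^i[f](t,\kappa)[\![w_1,\dots,w_i]\!]$ denote the first and second partial derivatives of this expression in the first argument $t$, with $\kappa$ and $w_1,\dots,w_i$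 held fixed. *)

theory Defs
  imports "HOL-Analysis.Analysis"
begin

definition Cc_plus :: "(real^3 \<Rightarrow> real) set" where
  "Cc_plus = {u. continuous_on UNIV u \<and> closure {x. u x \<noteq> 0} \<noteq> {} \<and>
                 compact (closure {x. u x \<noteq> 0}) \<and> (\<forall>x. 0 \<le> u x)}"

primrec C_k :: "nat \<Rightarrow> (real \<Rightarrow> 'a::real_normed_vector) \<Rightarrow> bool" where
  "C_k 0 f \<longleftrightarrow> continuous_on UNIV f"
| "C_k (Suc n) f \<longleftrightarrow>
     (\<forall>t. f differentiable (at t)) \<and> C_k n (\<lambda>t. vector_derivative f (at t))"

text \<open>Center of mass of a density; used both on \<open>\<real>\<^sup>3\<close> and on \<open>\<real>\<^sup>2\<close>.\<close>

definition center :: "('a::euclidean_space \<Rightarrow> real) \<Rightarrow> 'a" where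
  "center f = (1 / (LINT x|lborel. f x)) *\<^sub>R (LINT x|lborel. f x *\<^sub>R x)"

definition attenuation ::
  "(real^3 \<Rightarrow> real) \<Rightarrow> (real \<Rightarrow> real^3) \<Rightarrow> (real \<Rightarrow> real^3^3) \<Rightarrow> real \<Rightarrow> real^2 \<Rightarrow> real" where
  "attenuation u T R t x =
     (LINT x3|lborel. u (center u + R t *v (vector [x $ 1, x $ 2, x3] - center u + T t)))"

definition fourier2 :: "(real^2 \<Rightarrow> complex) \<Rightarrow> real^2 \<Rightarrow> complex" where
  "fourier2 f k = (1 / (2 * pi)) *\<^sub>R (LINT x|lborel. f x * exp (- \<i> * complex_of_real (k \<bullet> x)))"

definition reduced_attenuation ::
  "(real^3 \<Rightarrow> real) \<Rightarrow> (real \<Rightarrow> real^3) \<Rightarrow> (real \<Rightarrow> real^3^3) \<Rightarrow> real \<Rightarrow> real^2 \<Rightarrow> complex" where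
  "reduced_attenuation u T R t k =
     fourier2 (\<lambda>x. complex_of_real (attenuation u T R t x)) k *
     exp (\<i> * complex_of_real (k \<bullet> center (attenuation u T R t)))"

definition angular_velocity :: "(real \<Rightarrow> real^3^3) \<Rightarrow> (real \<Rightarrow> real^3) \<Rightarrow> bool" where
  "angular_velocity R \<omega> \<longleftrightarrow>
     (\<forall>t x. (transpose (R t) ** vector_derivative R (at t)) *v x = cross3 (\<omega> t) x)"

text \<open>\<open>\<alpha>\<close> and \<open>\<phi>\<close> are only required to be continuous. If \<open>\<omega>\<close> is differentiable, so are they
  wherever \<open>\<alpha> \<noteq> 0\<close>; elsewhere their \<open>deriv\<close> may be a meaningless value.\<close>

definition cylindrical_coords ::
  "(real \<Rightarrow> real^3) \<Rightarrow> (real \<Rightarrow> real) \<Rightarrow> (real \<Rightarrow> real^2) \<Rightarrow> (real \<Rightarrow> real) \<Rightarrow> (real \<Rightarrow> real) \<Rightarrow> bool" where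
  "cylindrical_coords \<omega> \<alpha> v \<phi> \<omega>3 \<longleftrightarrow>
     continuous_on UNIV \<alpha> \<and> (\<forall>t. 0 \<le> \<alpha> t) \<and>
     continuous_on UNIV v \<and> (\<forall>t. v t \<in> sphere 0 1) \<and>
     continuous_on UNIV \<phi> \<and>
     (\<forall>t. v t = vector [cos (\<phi> t), sin (\<phi> t)]) \<and>
     (\<forall>t. \<omega> t = vector [\<alpha> t * v t $ 1, \<alpha> t * v t $ 2, \<omega>3 t])"

definition perp :: "real^2 \<Rightarrow> real^2" where
  "perp w = vector [- w $ 2, w $ 1]"

text \<open>\<open>kderiv f t [w\<^sub>1, \<dots>, w\<^sub>i] \<kappa>\<close> is the \<open>i\<close>-th derivative tensor of \<open>k \<mapsto> f t k\<close> at \<open>\<kappa>\<close>,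
  evaluated at \<open>w\<^sub>1, \<dots>, w\<^sub>i\<close>: the order is the length of the list, and the \<open>(i+1)\<close>-st derivative
  is the Frechet derivative of the \<open>i\<close>-th one with its \<open>i\<close> arguments held fixed. \<open>frechet_derivative\<close> is
  arbitrary where no derivative exists; the reduced attenuation is smooth in \<open>k\<close>, being up to a
  phase the Fourier transform of a compactly supported function.\<close>

primrec kderiv ::
  "(real \<Rightarrow> 'a::real_normed_vector \<Rightarrow> 'b::real_normed_vector) \<Rightarrow> real \<Rightarrow> 'a list \<Rightarrow> 'a \<Rightarrow> 'b" where
  "kderiv f t [] = f t"
| "kderiv f t (w # ws) = (\<lambda>\<kappa>. frechet_derivative (kderiv f t ws) (at \<kappa>) w)"

abbreviation D ::
  "(real \<Rightarrow> 'a::real_normed_vector \<Rightarrow> 'b::real_normed_vector) \<Rightarrow> real \<Rightarrow> 'a \<Rightarrow> 'a list \<Rightarrow> 'b" where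
  "D f t \<kappa> ws \<equiv> kderiv f t ws \<kappa>"

definition dt_D ::
  "(real \<Rightarrow> 'a::real_normed_vector \<Rightarrow> 'b::real_normed_vector) \<Rightarrow> real \<Rightarrow> 'a \<Rightarrow> 'a list \<Rightarrow> 'b" where
  "dt_D f t \<kappa> ws = vector_derivative (\<lambda>s. D f s \<kappa> ws) (at t)"

definition dtt_D ::
  "(real \<Rightarrow> 'a::real_normed_vector \<Rightarrow> 'b::real_normed_vector) \<Rightarrow> real \<Rightarrow> 'a \<Rightarrow> 'a list \<Rightarrow> 'b" where
  "dtt_D f t \<kappa> ws = vector_derivative (\<lambda>s. dt_D f s \<kappa> ws) (at t)"

text \<open>In the coefficients, \<open>v\<close>, \<open>\<omega>3\<close>, \<open>\<omega>3'\<close> and \<open>\<sigma>\<close> are the values at the time \<open>t\<close>.\<close>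

definition coeff_A0 ::
  "(real \<Rightarrow> real^2 \<Rightarrow> complex) \<Rightarrow> real \<Rightarrow> real^2 \<Rightarrow> real \<Rightarrow> real \<Rightarrow> real \<Rightarrow> real \<Rightarrow> complex" where
  "coeff_A0 f t v \<omega>3 \<omega>3' \<sigma> \<mu> =
     (1/4 * \<mu> * (\<omega>3 + \<sigma>)) *\<^sub>R
       ((\<mu>\<^sup>2 * \<omega>3 * (\<omega>3 - \<sigma>)) *\<^sub>R D f t (\<mu> *\<^sub>R v) [perp v, perp v, perp v]
        + (2 * \<mu>) *\<^sub>R D f t (\<mu> *\<^sub>R v) [perp v, (\<omega>3 * \<sigma>) *\<^sub>R v - \<omega>3' *\<^sub>R perp v]
        + 2 *\<^sub>R D f t (\<mu> *\<^sub>R v) [\<omega>3\<^sup>2 *\<^sub>R perp v + \<omega>3' *\<^sub>R v]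
        - (\<mu> * (3 * \<omega>3 - \<sigma>)) *\<^sub>R dt_D f t (\<mu> *\<^sub>R v) [perp v, perp v]
        + 2 *\<^sub>R dtt_D f t (\<mu> *\<^sub>R v) [perp v])"

definition coeff_A02 ::
  "(real \<Rightarrow> real^2 \<Rightarrow> complex) \<Rightarrow> real \<Rightarrow> real^2 \<Rightarrow> real \<Rightarrow> real \<Rightarrow> real \<Rightarrow> complex" where
  "coeff_A02 f t v \<omega>3 \<sigma> \<mu> = (1/2 * \<mu> * (\<omega>3 + \<sigma>)) *\<^sub>R D f t (\<mu> *\<^sub>R v) [perp v]"

definition coeff_A1 ::
  "(real \<Rightarrow> real^2 \<Rightarrow> complex) \<Rightarrow> real \<Rightarrow> real^2 \<Rightarrow> real \<Rightarrow> real \<Rightarrow> real \<Rightarrow> complex" where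
  "coeff_A1 f t v \<omega>3 \<sigma> \<mu> =
     (1/2 * (\<omega>3 + \<sigma>)) *\<^sub>R
       ((\<mu> * \<omega>3) *\<^sub>R D f t (\<mu> *\<^sub>R v) [perp v, perp v]
        - \<omega>3 *\<^sub>R D f t (\<mu> *\<^sub>R v) [v]
        - dt_D f t (\<mu> *\<^sub>R v) [perp v])"

end

theory Submission
  imports Defs
begin

text \<open>Centering cancels the translation: the reduced attenuation is \<open>J(t,k) = G(R(t)(k,0))\<close>, where \<open>G\<close>
  is up to a constant the Fourier transform of \<open>u\<close> moved to its center of mass (a projection slice
  theorem). As \<open>u\<close> has compact support, all derivatives of \<open>G\<close> are obtained under the integral sign.
  Put \<open>l(z) = -\<i> \<langle>R(t)z, y\<rangle>\<close>. Every term of the claim is then an integral of \<open>u e\<^sup>l\<close> against a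
  polynomial in \<open>l(v,0)\<close>, \<open>l(v\<^sup>\<bottom>,0)\<close>, \<open>l(e\<^sub>3)\<close>, since a time derivative replaces \<open>l(z)\<close> by
  \<open>l(\<omega> \<times> z)\<close> or, the second time, by \<open>l(\<omega> \<times> (\<omega> \<times> z) + \<omega>' \<times> z)\<close>. These polynomials sum to zero
  identically.\<close>

section \<open>Invariance of Lebesgue measure\<close>

text \<open>Lebesgue measure is determined by its values on open boxes. The preimage of a box is its
  image under the inverse map, which is again orthogonal and hence preserves volume.\<close>

lemma lborel_distr_orthogonal:
  fixes f :: "real^'n::{finite,wellorder} \<Rightarrow> real^'n::_"
  assumes f: "orthogonal_transformation f"
  shows "distr lborel borel f = lborel"
proof (rule lborel_eqI[symmetric])
  fix l u :: "real^'n::{finite,wellorder}" assume le: "\<And>b. b \<in> Basis \<Longrightarrow> l \<bullet> b \<le> u \<bullet> b"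
  have lin: "linear f" and bij: "bij f"
    using f orthogonal_transformation_linear orthogonal_transformation_bij by blast+
  have meas: "f \<in> borel_measurable borel"
    using lin by (intro borel_measurable_continuous_onI linear_continuous_on)
      (simp add: linear_conv_bounded_linear)
  have inv: "orthogonal_transformation (inv f)"
    using f by (rule orthogonal_transformation_inv)
  have vim: "f -` box l u = inv f ` box l u"
    using bij by (rule bij_vimage_eq_inv_image)
  have "f -` box l u \<in> sets borel"
    using measurable_sets[OF meas, of "box l u"] by simp
  then have "emeasure lborel (f -` box l u) = emeasure lebesgue (f -` box l u)"
    by simp
  also have "\<dots> = measure lebesgue (f -` box l u)"
    unfolding vim
    by (rule emeasure_eq_measure2) (rule measurable_orthogonal_image[OF inv], simp)
  also have "measure lebesgue (f -` box l u) = measure lebesgue (box l u)"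
    unfolding vim by (rule measure_orthogonal_image[OF inv]) simp
  also have "ennreal \<dots> = (\<Prod>b\<in>Basis. (u - l) \<bullet> b)"
    using le by (simp add: measure_lborel_box_eq)
  finally show "emeasure (distr lborel borel f) (box l u) = (\<Prod>b\<in>Basis. (u - l) \<bullet> b)"
    using meas by (simp add: emeasure_distr)
qed simp

section \<open>Splitting space into the image plane and the beam direction\<close>

definition append3 :: "real^2 \<Rightarrow> real \<Rightarrow> real^3" where
  "append3 x z = vector [x $ 1, x $ 2, z]"

definition drop3 :: "real^3 \<Rightarrow> real^2" where
  "drop3 p = vector [p $ 1, p $ 2]"

lemma append3_nth [simp]: "append3 x z $ 1 = x $ 1" "append3 x z $ 2 = x $ 2" "append3 x z $ 3 = z"
  by (simp_all add: append3_def)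

lemma drop3_nth [simp]: "drop3 p $ 1 = p $ 1" "drop3 p $ 2 = p $ 2"
  by (simp_all add: drop3_def)

lemma drop3_append3 [simp]: "drop3 (append3 x z) = x"
  by (simp add: vec_eq_iff forall_2)

text \<open>The embedding is the adjoint of the projection. In the projection slice theorem this
  turns a frequency of the plane into a spatial one orthogonal to the beam.\<close>

lemma inner_drop3: "k \<bullet> drop3 p = append3 k 0 \<bullet> p"
  by (simp add: inner_vec_def sum_2 sum_3)

lemma bounded_linear_drop3: "bounded_linear drop3"
  unfolding linear_conv_bounded_linear[symmetric]
  by (rule linearI) (simp_all add: vec_eq_iff forall_2)

lemma bounded_linear_append3: "bounded_linear (\<lambda>k. append3 k 0)"
  unfolding linear_conv_bounded_linear[symmetric]
  by (rule linearI) (simp_all add: vec_eq_iff forall_3)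

lemma bounded_linear_append3_prod: "bounded_linear (\<lambda>(x, z). append3 x z)"
  unfolding linear_conv_bounded_linear[symmetric]
  by (rule linearI) (auto simp add: vec_eq_iff forall_3)

lemma prod_Basis_inner_vec: "(\<Prod>b\<in>Basis. f ((u::real^'n) \<bullet> b)) = (\<Prod>i\<in>UNIV. f (u $ i))"
proof -
  have "(\<Prod>b\<in>Basis. f (u \<bullet> b)) = (\<Prod>b\<in>range (\<lambda>i. axis i (1::real)). f (u \<bullet> b))"
    by (rule prod.cong) (auto simp: Basis_vec_def)
  also have "\<dots> = (\<Prod>i\<in>UNIV. f (u $ i))"
    by (subst prod.reindex) (auto simp: inj_on_def axis_eq_axis inner_axis)
  finally show ?thesis .
qed

text \<open>The preimage of a box is the product of a plane box and an interval, and volumes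
  multiply. This makes Fubini available along the beam.\<close>

lemma lborel_distr_append3:
  "distr (lborel :: ((real^2) \<times> real) measure) borel (\<lambda>(x, z). append3 x z) = lborel"
proof (rule lborel_eqI[symmetric])
  fix l u :: "real^3" assume le: "\<And>b. b \<in> Basis \<Longrightarrow> l \<bullet> b \<le> u \<bullet> b"
  let ?f = "\<lambda>(x, z). append3 x z"
  have [measurable]: "?f \<in> borel_measurable borel"
    by (intro borel_measurable_continuous_onI linear_continuous_on bounded_linear_append3_prod)
  have le': "l $ i \<le> u $ i" for i
    using le[of "axis i 1"] by (simp add: inner_axis)
  have "drop3 l $ i \<le> drop3 u $ i" for i
    using le' exhaust_2[of i] by auto
  then have le2: "drop3 l \<bullet> b \<le> drop3 u \<bullet> b" if "b \<in> Basis" for b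
    using that by (auto simp: Basis_vec_def inner_axis)
  \<comment> \<open>\<open>Sigma\<close>, because \<open>\<times>\<close> denotes the cross product here\<close>
  have vim: "?f -` box l u = Sigma (box (drop3 l) (drop3 u)) (\<lambda>_. box (l $ 3) (u $ 3))"
    by (auto simp: mem_box_cart forall_3 forall_2)
  have "emeasure lborel (?f -` box l u) =
      emeasure lborel (box (drop3 l) (drop3 u)) * emeasure lborel (box (l $ 3) (u $ 3))"
    unfolding vim lborel_prod[symmetric]
    by (rule lborel.emeasure_pair_measure_Times) auto
  also have "\<dots> = ennreal (\<Prod>b\<in>Basis. (drop3 u - drop3 l) \<bullet> b) * ennreal (u $ 3 - l $ 3)"
    using le' le2 by (subst emeasure_lborel_box) auto
  also have "\<dots> = (\<Prod>b\<in>Basis. (u - l) \<bullet> b)"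
  proof -
    have "(\<Prod>b\<in>Basis. (u - l) \<bullet> b) = (\<Prod>b\<in>Basis. (drop3 u - drop3 l) \<bullet> b) * (u $ 3 - l $ 3)"
      unfolding prod_Basis_inner_vec[where f = "\<lambda>x. x"] UNIV_2 UNIV_3 by simp
    moreover have "0 \<le> u $ 3 - l $ 3"
      using le'[of 3] by simp
    ultimately show ?thesis
      by (simp only: ennreal_mult'')
  qed
  finally show "emeasure (distr lborel borel ?f) (box l u) = (\<Prod>b\<in>Basis. (u - l) \<bullet> b)"
    by (simp add: emeasure_distr)
qed simp

section \<open>Integrals of compactly supported functions and rigid motions\<close>

lemma integrable_compact_support:
  fixes f :: "'a::euclidean_space \<Rightarrow> 'b::{banach, second_countable_topology}"
  assumes "continuous_on UNIV f" "compact S" "\<And>x. x \<notin> S \<Longrightarrow> f x = 0"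
  shows "integrable lborel f"
proof -
  have "(\<lambda>x. indicator S x *\<^sub>R f x) = f"
    using assms(3) by (auto simp: fun_eq_iff split: split_indicator)
  then show ?thesis
    using borel_integrable_compact[OF assms(2) continuous_on_subset[OF assms(1)]] by simp
qed

text \<open>Passes from the Lebesgue integral to the gauge integral over a box, for which
  differentiation under the integral sign is carried out later.\<close>

lemma integral_compact_support_cbox:
  fixes f :: "'a::euclidean_space \<Rightarrow> 'b::euclidean_space"
  assumes f: "continuous_on UNIV f" and S: "\<And>x. x \<notin> cbox a b \<Longrightarrow> f x = 0"
  shows "integral\<^sup>L lborel f = integral (cbox a b) f"
proof -
  have "(\<lambda>x. indicator (cbox a b) x *\<^sub>R f x) = f"
    using S by (auto simp: fun_eq_iff split: split_indicator)
  then show ?thesis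
    using set_borel_integral_eq_integral(2)[of "cbox a b" f] integrable_compact_support[OF f compact_cbox S]
    by (simp add: set_integrable_def set_lebesgue_integral_def)
qed

lemma integral_lborel_append3:
  fixes F :: "real^3 \<Rightarrow> 'b::{banach, second_countable_topology}"
  assumes "integrable lborel F"
  shows "(LINT x|lborel. LINT z|lborel. F (append3 x z)) = integral\<^sup>L lborel F"
proof -
  let ?f = "\<lambda>(x, z). append3 x z"
  have meas: "?f \<in> borel_measurable borel"
    by (intro borel_measurable_continuous_onI linear_continuous_on bounded_linear_append3_prod)
  then have meas': "?f \<in> measurable lborel borel"
    by simp
  have F: "F \<in> borel_measurable borel"
    using borel_measurable_integrable[OF assms] by simp
  have int: "integrable (lborel \<Otimes>\<^sub>M lborel) (\<lambda>q. F (?f q))"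
    using assms integrable_distr_eq[OF meas' F] by (simp add: lborel_distr_append3 lborel_prod)
  show "(LINT x|lborel. LINT z|lborel. F (append3 x z)) = integral\<^sup>L lborel F"
    using lborel_pair.integral_fst'[OF int] integral_distr[OF meas' F]
    by (simp add: lborel_distr_append3 lborel_prod)
qed

text \<open>The order, first a translation and then an orthogonal map, is that of the motion inside
  \<open>attenuation\<close>.\<close>

lemma integral_rigid_motion:
  fixes f :: "real^'n::{finite,wellorder} \<Rightarrow> real^'n::_"
    and H :: "real^'n::_ \<Rightarrow> 'b::{banach, second_countable_topology}"
  assumes f: "orthogonal_transformation f" and H: "integrable lborel H"
  shows "integrable lborel (\<lambda>p. H (f (b + p)))"
    and "(LINT p|lborel. H (f (b + p))) = integral\<^sup>L lborel H"
proof -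
  have meas: "f \<in> measurable lborel borel"
    using f by (simp, intro borel_measurable_continuous_onI linear_continuous_on)
      (simp add: orthogonal_transformation_linear flip: linear_conv_bounded_linear)
  have Hm: "H \<in> borel_measurable borel"
    using borel_measurable_integrable[OF H] by simp
  have Hf: "(\<lambda>p. H (f p)) \<in> borel_measurable borel"
    using measurable_comp[OF meas Hm] by (simp add: comp_def)
  have int: "integrable lborel (\<lambda>p. H (f p))"
    using H integrable_distr_eq[OF meas Hm] by (simp add: lborel_distr_orthogonal[OF f])
  have tr: "(+) b \<in> measurable lborel borel"
    by simp
  show "integrable lborel (\<lambda>p. H (f (b + p)))"
    using int integrable_distr_eq[OF tr Hf] by (simp add: lborel_distr_plus)
  show "(LINT p|lborel. H (f (b + p))) = integral\<^sup>L lborel H"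
    using integral_distr[OF meas Hm] integral_distr[OF tr Hf]
    by (simp add: lborel_distr_plus lborel_distr_orthogonal[OF f])
qed

section \<open>The reduced attenuation as a Fourier integral\<close>

text \<open>The box has nonempty interior so that \<open>integral_Cc_plus_pos\<close> can conclude
  from a zero integral that the density vanishes on it.\<close>

lemma Cc_plus_translate:
  assumes "u \<in> Cc_plus"
  obtains a b where "box a b \<noteq> {}" "\<And>y. y \<notin> cbox a b \<Longrightarrow> u (c + y) = 0"
proof -
  let ?S = "(+) (- c) ` closure {x. u x \<noteq> 0}"
  have "compact ?S"
    using assms by (intro compact_translation) (auto simp: Cc_plus_def)
  then obtain a where a: "?S \<subseteq> box (- a) a"
    using bounded_subset_box_symmetric compact_imp_bounded by blast
  have "?S \<noteq> {}"
    using assms by (auto simp: Cc_plus_def)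
  then have ne: "box (- a) a \<noteq> {}"
    using a by force
  have "u (c + y) = 0" if "y \<notin> cbox (- a) a" for y
  proof (rule ccontr)
    assume "u (c + y) \<noteq> 0"
    then have "c + y \<in> closure {x. u x \<noteq> 0}"
      using closure_subset by fastforce
    then have "- c + (c + y) \<in> ?S"
      by (rule imageI)
    then show False
      using a box_subset_cbox[of "- a" a] that by auto
  qed
  then show ?thesis
    by (rule that[OF ne])
qed

lemma Cc_plus_continuous: "u \<in> Cc_plus \<Longrightarrow> continuous_on UNIV (\<lambda>y. u (c + y))"
  by (intro continuous_on_compose2[where s = UNIV and g = u] continuous_intros) (auto simp: Cc_plus_def)

lemma integrable_Cc_plus_scaleR:
  fixes h :: "real^3 \<Rightarrow> 'b::euclidean_space"
  assumes u: "u \<in> Cc_plus" and h: "continuous_on UNIV h"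
  shows "integrable lborel (\<lambda>y. u (c + y) *\<^sub>R h y)"
proof -
  obtain a b where "\<And>y. y \<notin> cbox a b \<Longrightarrow> u (c + y) = 0"
    using Cc_plus_translate[OF u] by blast
  then show ?thesis
    using u h by (intro integrable_compact_support[where S = "cbox a b"] continuous_intros Cc_plus_continuous) auto
qed

lemma integral_Cc_plus_translate:
  fixes h :: "real^3 \<Rightarrow> 'b::euclidean_space"
  assumes u: "u \<in> Cc_plus" and h: "continuous_on UNIV h"
  shows "(LINT y|lborel. u (c + y) *\<^sub>R h (c + y)) = (LINT y|lborel. u y *\<^sub>R h y)"
  using integral_rigid_motion(2)[where f = "\<lambda>x. x" and b = c and H = "\<lambda>y. u y *\<^sub>R h y"]
    integrable_Cc_plus_scaleR[OF assms, of 0]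
  by (simp add: orthogonal_transformation_def linear_id[unfolded id_def])

text \<open>A continuous nonnegative function with integral zero over a nondegenerate box vanishes
  there; then the support would be empty. Positivity permits cancelling the mass in
  \<open>center\<close>.\<close>

lemma integral_Cc_plus_pos:
  assumes u: "u \<in> Cc_plus"
  shows "integral\<^sup>L lborel u > 0"
proof -
  obtain a b where ab: "box a b \<noteq> {}" "\<And>y. y \<notin> cbox a b \<Longrightarrow> u y = 0"
    using Cc_plus_translate[OF u, of 0] by auto
  have cont: "continuous_on UNIV u" and nn: "\<And>x. 0 \<le> u x"
    using u by (auto simp: Cc_plus_def)
  have eq: "integral\<^sup>L lborel u = integral (cbox a b) u"
    using cont ab by (intro integral_compact_support_cbox)
  have "integral (cbox a b) u \<noteq> 0"
  proof
    assume "integral (cbox a b) u = 0"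
    then have "(u has_integral 0) (cbox a b)"
      using integrable_continuous[OF continuous_on_subset[OF cont], of a b]
      by (metis integrable_integral subset_UNIV)
    then have "u x = 0" if "x \<in> cbox a b" for x
      using has_integral_0_cbox_imp_0[OF continuous_on_subset[OF cont] nn _ ab(1) that] by auto
    then have "{x. u x \<noteq> 0} = {}"
      using ab(2) by blast
    then show False
      using u by (simp add: Cc_plus_def)
  qed
  moreover have "integral\<^sup>L lborel u \<ge> 0"
    using nn by (simp add: integral_nonneg_AE)
  ultimately show ?thesis
    using eq by simp
qed

text \<open>After shifting the variable, the integral is the first moment of \<open>u\<close> minus
  its mass times \<open>center u\<close>, and these agree by the choice of the center.\<close>

lemma integral_centered:
  assumes u: "u \<in> Cc_plus"
  shows "(LINT y|lborel. u (center u + y) *\<^sub>R y) = 0"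
proof -
  let ?I = "integral\<^sup>L lborel u" and ?c = "center u"
  have "(LINT y|lborel. u (?c + y) *\<^sub>R y) = (LINT y|lborel. u y *\<^sub>R (y - ?c))"
    using integral_Cc_plus_translate[OF u, of "\<lambda>y. y - ?c" ?c] by (simp add: continuous_intros)
  also have "\<dots> = (LINT y|lborel. u y *\<^sub>R y) - (LINT y|lborel. u y *\<^sub>R ?c)"
    using integrable_Cc_plus_scaleR[OF u, of "\<lambda>y. y" 0] integrable_Cc_plus_scaleR[OF u, of "\<lambda>y. ?c" 0]
    by (simp add: scaleR_diff_right continuous_intros)
  also have "(LINT y|lborel. u y *\<^sub>R ?c) = ?I *\<^sub>R ?c"
    using integrable_Cc_plus_scaleR[OF u, of "\<lambda>y. 1::real" 0] by simp
  finally show ?thesis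
    using integral_Cc_plus_pos[OF u] by (simp add: center_def)
qed

text \<open>Fubini joins the plane and the beam to an integral over points \<open>p\<close> of
  space, and the substitution \<open>y = R(t)(p - center u + T(t))\<close> moves the motion from
  \<open>u\<close> to \<open>h\<close>. The mass, the first moment and the Fourier transform of the
  attenuation are all instances.\<close>

lemma integral_attenuation:
  fixes h :: "real^2 \<Rightarrow> 'b::euclidean_space"
  assumes u: "u \<in> Cc_plus" and Q: "rotation_matrix (R t)" and h: "continuous_on UNIV h"
  shows "(LINT x|lborel. attenuation u T R t x *\<^sub>R h x) =
    (LINT y|lborel. u (center u + y) *\<^sub>R h (drop3 (center u - T t + transpose (R t) *v y)))"
proof -
  let ?c = "center u" and ?Q = "(*v) (R t)" and ?b = "T t - center u"
  define H where "H y = u (?c + y) *\<^sub>R h (drop3 (?c - T t + transpose (R t) *v y))" for y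
  have orth: "orthogonal_transformation ?Q"
    using Q by (simp add: orthogonal_transformation_matrix rotation_matrix_def)
  have H: "integrable lborel H"
    unfolding H_def
    by (intro integrable_Cc_plus_scaleR[OF u] continuous_on_compose2[OF h]
      linear_continuous_on_compose[OF _ linear_conv_bounded_linear[THEN iffD2, OF bounded_linear_drop3]]
      continuous_intros matrix_vector_mult_linear_continuous_on) auto
  \<comment> \<open>The rotation in \<open>?Q\<close> cancels against the transpose in
    \<open>H\<close>, so the argument of \<open>h\<close> collapses to
    \<open>drop3 p\<close>.\<close>
  have HQ: "H (?Q (?b + p)) = u (?c + ?Q (p - ?c + T t)) *\<^sub>R h (drop3 p)" for p
    using Q by (simp add: H_def rotation_matrix_def orthogonal_matrix_def matrix_vector_mul_assoc
      algebra_simps)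
  have "integral\<^sup>L lborel H = (LINT p|lborel. H (?Q (?b + p)))"
    using integral_rigid_motion[OF orth H] by simp
  also have "\<dots> = (LINT x|lborel. LINT z|lborel. u (?c + ?Q (append3 x z - ?c + T t)) *\<^sub>R h x)"
    using integral_lborel_append3[OF integral_rigid_motion(1)[OF orth H], of ?b] by (simp add: HQ)
  also have "\<dots> = (LINT x|lborel. attenuation u T R t x *\<^sub>R h x)"
  proof (rule Bochner_Integration.integral_cong[OF refl])
    fix x
    obtain a b where ab: "\<And>y. y \<notin> cbox a b \<Longrightarrow> u (?c + y) = 0"
      using Cc_plus_translate[OF u] by blast
    obtain B where B: "\<And>y. y \<in> cbox a b \<Longrightarrow> norm y \<le> B"
      using bounded_cbox bounded_iff by metis
    \<comment> \<open>Integrability along the beam allows \<open>h x\<close> to be pulled out of the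
      inner integral. Rotations preserve norms, and the norm dominates the third coordinate, so the
      integrand vanishes once that coordinate exceeds the bound \<open>B\<close> of the
      support.\<close>
    have "integrable lborel (\<lambda>z. u (?c + ?Q (append3 x z - ?c + T t)))"
    proof (rule integrable_compact_support[where S = "cbox (?c $ 3 - T t $ 3 - B) (?c $ 3 - T t $ 3 + B)"])
      have "continuous_on UNIV (\<lambda>z. append3 x z)"
        using continuous_on_compose2[OF linear_continuous_on[OF bounded_linear_append3_prod, of UNIV],
          of UNIV "\<lambda>z. (x, z)"] by (simp add: continuous_intros)
      then show "continuous_on UNIV (\<lambda>z. u (?c + ?Q (append3 x z - ?c + T t)))"
        by (intro continuous_on_compose2[OF Cc_plus_continuous[OF u]]
          continuous_on_compose2[OF matrix_vector_mult_linear_continuous_on] continuous_intros) auto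
    next
      fix z assume "z \<notin> cbox (?c $ 3 - T t $ 3 - B) (?c $ 3 - T t $ 3 + B)"
      then have "B < \<bar>(append3 x z - ?c + T t) $ 3\<bar>"
        by (auto simp: abs_if)
      also have "\<dots> \<le> norm (append3 x z - ?c + T t)"
        by (rule component_le_norm_cart)
      also have "\<dots> = norm (?Q (append3 x z - ?c + T t))"
        using orth by (simp add: orthogonal_transformation_norm)
      finally show "u (?c + ?Q (append3 x z - ?c + T t)) = 0"
        using ab B by (meson linorder_not_le)
    qed simp
    then show "(LINT z|lborel. u (?c + ?Q (append3 x z - ?c + T t)) *\<^sub>R h x) = attenuation u T R t x *\<^sub>R h x"
      by (simp add: attenuation_def append3_def)
  qed
  finally show ?thesis
    unfolding H_def by (rule sym)
qed

text \<open>The projected point is a constant plus a term linear in \<open>y\<close>. By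
  \<open>integral_centered\<close> the linear term integrates to zero, so the rotation drops out of
  the center.\<close>

lemma center_attenuation:
  assumes u: "u \<in> Cc_plus" and Q: "rotation_matrix (R t)"
  shows "center (attenuation u T R t) = drop3 (center u - T t)"
proof -
  let ?I = "integral\<^sup>L lborel u" and ?c = "center u" and ?A = "attenuation u T R t"
  let ?Q = "(*v) (transpose (R t))"
  interpret d: bounded_linear drop3 by (rule bounded_linear_drop3)
  have lin: "bounded_linear (\<lambda>y. drop3 (?Q y))"
    using bounded_linear_compose[OF bounded_linear_drop3 matrix_vector_mul_bounded_linear] .
  interpret q: bounded_linear "\<lambda>y. drop3 (?Q y)" by (rule lin)
  have I: "(LINT y|lborel. u (?c + y)) = ?I"
    using integral_Cc_plus_translate[OF u, of "\<lambda>y. 1::real" ?c] by simp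
  have int1: "integrable lborel (\<lambda>y. u (?c + y))"
    using integrable_Cc_plus_scaleR[OF u, of "\<lambda>y. 1::real" ?c] by simp
  have inty: "integrable lborel (\<lambda>y. u (?c + y) *\<^sub>R y)"
    by (intro integrable_Cc_plus_scaleR[OF u] continuous_intros)
  have "integral\<^sup>L lborel ?A = ?I"
    using integral_attenuation[where R = R and t = t, OF u Q, of "\<lambda>y. 1::real" T] I by simp
  moreover have "(LINT x|lborel. ?A x *\<^sub>R x) = ?I *\<^sub>R drop3 (?c - T t)"
  proof -
    have "(LINT x|lborel. ?A x *\<^sub>R x) = (LINT y|lborel. u (?c + y) *\<^sub>R drop3 (?c - T t + ?Q y))"
      by (intro integral_attenuation[where R = R and t = t, OF u Q] continuous_intros)
    also have "\<dots> = (LINT y|lborel. u (?c + y) *\<^sub>R drop3 (?c - T t) + drop3 (?Q (u (?c + y) *\<^sub>R y)))"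
      by (simp only: d.add q.scaleR scaleR_add_right)
    also have "\<dots> = ?I *\<^sub>R drop3 (?c - T t) + drop3 (?Q (LINT y|lborel. u (?c + y) *\<^sub>R y))"
      using int1 inty integrable_bounded_linear[OF lin inty] integral_bounded_linear[OF lin inty]
      by (simp add: I)
    finally show ?thesis
      using integral_centered[OF u] q.zero by simp
  qed
  ultimately show ?thesis
    using integral_Cc_plus_pos[OF u] by (simp add: center_def)
qed

text \<open>With a plane wave for \<open>h\<close>, the part of the phase coming from
  \<open>center u - T t\<close> is constant in \<open>y\<close>. By
  \<open>center_attenuation\<close> it is exactly what the phase factor of the reduced map cancels,
  while the rotation passes to the frequency.\<close>

lemma reduced_attenuation_eq:
  assumes u: "u \<in> Cc_plus" and Q: "rotation_matrix (R t)"
  shows "reduced_attenuation u T R t k = (1 / (2 * pi)) *\<^sub>R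
    (LINT y|lborel. u (center u + y) *\<^sub>R exp (- \<i> * complex_of_real ((R t *v append3 k 0) \<bullet> y)))"
proof -
  let ?c = "center u" and ?Q = "(*v) (transpose (R t))"
  let ?e = "\<lambda>r. exp (- \<i> * complex_of_real r)"
  have inner: "k \<bullet> drop3 (?c - T t + ?Q y) = k \<bullet> drop3 (?c - T t) + (R t *v append3 k 0) \<bullet> y" for y
    by (simp add: inner_drop3 inner_add_right dot_lmul_matrix inner_commute[of "append3 k 0" "y v* R t"]
      inner_commute[of y])
  have "(LINT x|lborel. complex_of_real (attenuation u T R t x) * ?e (k \<bullet> x)) =
      (LINT x|lborel. attenuation u T R t x *\<^sub>R ?e (k \<bullet> x))"
    by (simp add: scaleR_conv_of_real)
  also have "\<dots> = (LINT y|lborel. u (?c + y) *\<^sub>R ?e (k \<bullet> drop3 (?c - T t + ?Q y)))"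
    by (intro integral_attenuation[where R = R and t = t, OF u Q] continuous_intros)
  also have "\<dots> = (LINT y|lborel. (u (?c + y) *\<^sub>R ?e ((R t *v append3 k 0) \<bullet> y)) * ?e (k \<bullet> drop3 (?c - T t)))"
    unfolding inner by (simp add: distrib_left exp_diff exp_minus field_simps)
  also have "\<dots> = (LINT y|lborel. u (?c + y) *\<^sub>R ?e ((R t *v append3 k 0) \<bullet> y)) * ?e (k \<bullet> drop3 (?c - T t))"
    by (rule integral_mult_left_zero)
  finally show ?thesis
    by (simp add: reduced_attenuation_def fourier2_def center_attenuation[where R = R and t = t, OF assms] mult.assoc flip: exp_add)
qed

text \<open>One box and one weight serve all \<open>t\<close> and \<open>k\<close>: the weight
  absorbs the density and the Fourier constant, so that derivatives act on the exponential
  alone.\<close>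

lemma reduced_attenuation_cbox:
  assumes u: "u \<in> Cc_plus" and Q: "\<And>t. rotation_matrix (R t)"
  obtains a b :: "real^3" and W :: "real^3 \<Rightarrow> complex" where
    "continuous_on (cbox a b) W"
    "\<And>t k. reduced_attenuation u T R t k =
      integral (cbox a b) (\<lambda>y. W y * exp (- \<i> * complex_of_real ((R t *v append3 k 0) \<bullet> y)))"
proof -
  obtain a b where ab: "\<And>y. y \<notin> cbox a b \<Longrightarrow> u (center u + y) = 0"
    using Cc_plus_translate[OF u] by blast
  define W where "W y = complex_of_real (u (center u + y) / (2 * pi))" for y
  note cont = continuous_on_subset[OF Cc_plus_continuous[OF u, of "center u"]]
  show ?thesis
  proof (rule that[of a b W])
    show "continuous_on (cbox a b) W"
      unfolding W_def by (intro continuous_intros cont) auto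
    fix t k
    let ?e = "\<lambda>y. exp (- \<i> * complex_of_real ((R t *v append3 k 0) \<bullet> y))"
    have "(LINT y|lborel. u (center u + y) *\<^sub>R ?e y) = integral (cbox a b) (\<lambda>y. u (center u + y) *\<^sub>R ?e y)"
      using ab by (intro integral_compact_support_cbox continuous_intros cont) auto
    then show "reduced_attenuation u T R t k = integral (cbox a b) (\<lambda>y. W y * ?e y)"
      unfolding reduced_attenuation_eq[where R = R and t = t, OF assms] W_def
      by (simp add: scaleR_conv_of_real mult.assoc flip: integral_cmul integral_mult_right)
  qed
qed

section \<open>Differentiating Fourier integrals over a box\<close>

text \<open>The exponent is purely imaginary, so the factor \<open>exp |Re z|\<close> in the Taylor
  remainder is 1. Only the quadratic order matters later, not the constant.\<close>

lemma norm_exp_i_diff_le: "norm (exp (- \<i> * complex_of_real r) - 1 + \<i> * complex_of_real r) \<le> r\<^sup>2"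
  using Taylor_exp[of "- \<i> * complex_of_real r" 1] by (simp add: norm_mult power2_eq_square algebra_simps)

text \<open>The remainder is bounded, uniformly on the box, by the square of the increment.\<close>

lemma has_derivative_fourier_cbox:
  fixes V :: "'a::euclidean_space \<Rightarrow> complex" and L :: "'b::euclidean_space \<Rightarrow> 'a"
  assumes V: "continuous_on (cbox a b) V" and L: "linear L"
  shows "((\<lambda>k. integral (cbox a b) (\<lambda>y. V y * exp (- \<i> * complex_of_real (L k \<bullet> y)))) has_derivative
    (\<lambda>w. integral (cbox a b) (\<lambda>y. (V y * (- \<i> * complex_of_real (L w \<bullet> y))) *
      exp (- \<i> * complex_of_real (L k \<bullet> y))))) (at k)"
proof -
  let ?e = "\<lambda>r. exp (- \<i> * complex_of_real r)"
  let ?F = "\<lambda>k. integral (cbox a b) (\<lambda>y. V y * ?e (L k \<bullet> y))"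
  let ?D = "\<lambda>w. integral (cbox a b) (\<lambda>y. (V y * (- \<i> * complex_of_real (L w \<bullet> y))) * ?e (L k \<bullet> y))"
  have int: "(\<lambda>y. V y * ?e (L k \<bullet> y)) integrable_on cbox a b" for k
    by (intro integrable_continuous continuous_intros V)
  have intD: "(\<lambda>y. (V y * (- \<i> * complex_of_real (L w \<bullet> y))) * ?e (L k \<bullet> y)) integrable_on cbox a b" for w
    by (intro integrable_continuous continuous_intros V)
  have "linear ?D"
  proof (rule linearI)
    fix w w'
    show "?D (w + w') = ?D w + ?D w'"
      unfolding integral_add[OF intD intD, symmetric]
      by (intro integral_cong) (simp add: linear_add[OF L] inner_add_left algebra_simps)
    fix c
    show "?D (c *\<^sub>R w) = c *\<^sub>R ?D w"
      unfolding integral_cmul[symmetric]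
      by (intro integral_cong) (simp add: linear_cmul[OF L] scaleR_conv_of_real mult_ac)
  qed
  obtain M where M: "\<And>y. y \<in> cbox a b \<Longrightarrow> norm (V y) \<le> M" and "0 \<le> M"
    using compact_continuous_image[OF V compact_cbox, THEN compact_imp_bounded]
    unfolding bounded_pos by force
  obtain N where N: "\<And>y. y \<in> cbox a b \<Longrightarrow> norm y \<le> N" and "0 \<le> N"
    using bounded_cbox[of a b] unfolding bounded_pos by force
  obtain K where K: "\<And>w. norm (L w) \<le> K * norm w" and "0 < K"
    using linear_bounded_pos[OF L] by metis
  \<comment> \<open>On the box \<open>|L w \<bullet> y|\<close> is at most
    \<open>K * N * norm w\<close>. Its square bounds the Taylor remainder, \<open>M\<close> bounds
    the weight, and integration adds the volume.\<close>
  define B where "B = M * (K * N)\<^sup>2 * measure lborel (cbox a b)"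
  have bound: "norm (?F (k + w) - ?F k - ?D w) \<le> B * (norm w)\<^sup>2" for w
  proof -
    have "?F (k + w) - ?F k - ?D w = integral (cbox a b) (\<lambda>y. V y * ?e (L (k + w) \<bullet> y) - V y * ?e (L k \<bullet> y)
        - (V y * (- \<i> * complex_of_real (L w \<bullet> y))) * ?e (L k \<bullet> y))"
      by (simp only: Henstock_Kurzweil_Integration.integral_diff int intD integrable_diff)
    \<comment> \<open>Factoring out the wave at \<open>k\<close>, which has modulus 1, leaves the
      remainder estimated by \<open>norm_exp_i_diff_le\<close>.\<close>
    also have "\<dots> = integral (cbox a b) (\<lambda>y. V y * ?e (L k \<bullet> y) *
        (?e (L w \<bullet> y) - 1 + \<i> * complex_of_real (L w \<bullet> y)))"
      by (intro integral_cong) (simp add: linear_add[OF L] inner_add_left distrib_left exp_diff exp_minus field_simps)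
    also have "norm \<dots> \<le> M * (K * N)\<^sup>2 * (norm w)\<^sup>2 * measure lborel (cbox a b)"
    proof (rule has_integral_bound[OF _ integrable_integral])
      show "0 \<le> M * (K * N)\<^sup>2 * (norm w)\<^sup>2"
        using \<open>0 \<le> M\<close> by simp
      show "(\<lambda>y. V y * ?e (L k \<bullet> y) * (?e (L w \<bullet> y) - 1 + \<i> * complex_of_real (L w \<bullet> y))) integrable_on cbox a b"
        by (intro integrable_continuous continuous_intros V)
      fix y assume y: "y \<in> cbox a b"
      have "\<bar>L w \<bullet> y\<bar> \<le> (K * norm w) * N"
        using Cauchy_Schwarz_ineq2[of "L w" y] K[of w] N[OF y] \<open>0 < K\<close>
        by (meson mult_mono norm_ge_zero order_trans mult_nonneg_nonneg less_imp_le)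
      then have "(L w \<bullet> y)\<^sup>2 \<le> ((K * norm w) * N)\<^sup>2"
        by (metis abs_ge_zero power2_abs power_mono)
      then have "norm (?e (L w \<bullet> y) - 1 + \<i> * complex_of_real (L w \<bullet> y)) \<le> (K * N)\<^sup>2 * (norm w)\<^sup>2"
        using norm_exp_i_diff_le[of "L w \<bullet> y"] by (simp add: power_mult_distrib mult_ac)
      then have "norm (V y) * norm (?e (L w \<bullet> y) - 1 + \<i> * complex_of_real (L w \<bullet> y)) \<le> M * ((K * N)\<^sup>2 * (norm w)\<^sup>2)"
        using M[OF y] \<open>0 \<le> M\<close> by (intro mult_mono) auto
      then show "norm (V y * ?e (L k \<bullet> y) * (?e (L w \<bullet> y) - 1 + \<i> * complex_of_real (L w \<bullet> y))) \<le>
          M * (K * N)\<^sup>2 * (norm w)\<^sup>2"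
        by (simp add: norm_mult mult.assoc)
    qed
    finally show ?thesis
      by (simp add: B_def mult_ac)
  qed
  have "((\<lambda>w. norm (?F (k + w) - ?F k - ?D w) / norm w) \<longlongrightarrow> 0) (at 0)"
  proof (rule Lim_null_comparison)
    show "\<forall>\<^sub>F w in at 0. norm (norm (?F (k + w) - ?F k - ?D w) / norm w) \<le> B * norm w"
      unfolding eventually_at_filter
      using bound by (intro always_eventually) (auto simp: divide_le_eq power2_eq_square mult_ac)
    show "((\<lambda>w. B * norm w) \<longlongrightarrow> 0) (at (0::'b))"
      by (auto intro!: tendsto_eq_intros)
  qed
  then show ?thesis
    using \<open>linear ?D\<close> unfolding has_derivative_at linear_conv_bounded_linear by blast
qed

section \<open>Iterated frequency derivatives and time derivatives\<close>

definition fweight :: "('a::euclidean_space \<Rightarrow> complex) \<Rightarrow> 'a list \<Rightarrow> 'a \<Rightarrow> complex" where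
  "fweight W ws y = W y * (\<Prod>w\<leftarrow>ws. - \<i> * complex_of_real (w \<bullet> y))"

lemma continuous_on_fweight: "continuous_on S W \<Longrightarrow> continuous_on S (fweight W ws)"
proof (induction ws)
  case Nil
  then show ?case by (simp add: fweight_def[abs_def])
next
  case (Cons w ws)
  have "fweight W (w # ws) = (\<lambda>y. fweight W ws y * (- \<i> * complex_of_real (w \<bullet> y)))"
    by (auto simp: fweight_def mult_ac)
  with Cons show ?case
    by (simp del: mult_minus_left mult_minus_right) (intro continuous_intros)
qed

text \<open>Each differentiation pulls one linear factor out of the exponential, so the result is
  again a Fourier integral with a continuous weight and \<open>has_derivative_fourier_cbox\<close>
  applies anew. All derivatives exist, hence \<open>frechet_derivative\<close> never takes an
  arbitrary value here.\<close>

lemma kderiv_fourier_cbox: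
  fixes W :: "'a::euclidean_space \<Rightarrow> complex" and L :: "'b::euclidean_space \<Rightarrow> 'a"
  assumes W: "continuous_on (cbox a b) W" and L: "linear L"
    and f: "\<And>k. f t k = integral (cbox a b) (\<lambda>y. W y * exp (- \<i> * complex_of_real (L k \<bullet> y)))"
  shows "kderiv f t ws = (\<lambda>k. integral (cbox a b) (\<lambda>y. fweight W (map L ws) y *
    exp (- \<i> * complex_of_real (L k \<bullet> y))))"
proof (induction ws)
  case Nil
  show ?case using f by (simp add: fweight_def fun_eq_iff)
next
  case (Cons w ws)
  show ?case
    unfolding kderiv.simps Cons
      frechet_derivative_at[OF has_derivative_fourier_cbox[OF continuous_on_fweight[OF W] L], symmetric]
    by (simp add: fweight_def mult_ac)
qed

text \<open>Leibniz rule along a moving frequency \<open>p\<close>. The multiplier \<open>m\<close>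
  carries factors produced by earlier derivatives, which move with time too; this form can therefore
  be applied a second time.\<close>

lemma has_vector_derivative_fourier_cbox:
  fixes W :: "'a::euclidean_space \<Rightarrow> complex" and m m' :: "real \<Rightarrow> 'a \<Rightarrow> complex" and p p' :: "real \<Rightarrow> 'a"
  assumes W: "continuous_on (cbox a b) W"
    and m: "\<And>s y. ((\<lambda>s. m s y) has_vector_derivative m' s y) (at s)"
    and m_cont: "continuous_on (UNIV \<times> cbox a b) (\<lambda>(s, y). m s y)"
    and m'_cont: "continuous_on (UNIV \<times> cbox a b) (\<lambda>(s, y). m' s y)"
    and p: "\<And>s. (p has_vector_derivative p' s) (at s)"
    and p': "continuous_on UNIV p'"
  shows "((\<lambda>s. integral (cbox a b) (\<lambda>y. W y * m s y * exp (- \<i> * complex_of_real (p s \<bullet> y)))) has_vector_derivative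
    integral (cbox a b) (\<lambda>y. W y * (m' t y + m t y * (- \<i> * complex_of_real (p' t \<bullet> y))) *
      exp (- \<i> * complex_of_real (p t \<bullet> y)))) (at t)"
proof -
  let ?X = "UNIV \<times> cbox a b :: (real \<times> 'a) set"
  have pc: "continuous_on UNIV p"
    using p has_vector_derivative_continuous by (blast intro: continuous_at_imp_continuous_on)
  have W2: "continuous_on ?X (\<lambda>x. W (snd x))"
    by (intro continuous_on_compose2[OF W] continuous_intros) auto
  have p2: "continuous_on ?X (\<lambda>x. p (fst x))" "continuous_on ?X (\<lambda>x. p' (fst x))"
    by (intro continuous_on_compose2[OF pc] continuous_on_compose2[OF p'] continuous_intros; auto)+
  have my: "continuous_on (cbox a b) (m s)" for s
    using continuous_on_compose2[OF m_cont, of "cbox a b" "\<lambda>y. (s, y)"] by (simp add: continuous_intros image_subset_iff)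
  have e: "((\<lambda>s. exp (- \<i> * complex_of_real (p s \<bullet> y))) has_vector_derivative
      (- \<i> * complex_of_real (p' s \<bullet> y)) * exp (- \<i> * complex_of_real (p s \<bullet> y))) (at s)" for s y
  proof -
    have "((\<lambda>s. - \<i> * complex_of_real (p s \<bullet> y)) has_vector_derivative - \<i> * complex_of_real (p' s \<bullet> y)) (at s)"
      by (intro bounded_linear.has_vector_derivative[OF _ p] bounded_linear_const_mult
        bounded_linear_compose[OF bounded_linear_of_real] bounded_linear_inner_left)
    from field_vector_diff_chain_at[OF this DERIV_exp] show ?thesis
      by (simp add: comp_def)
  qed
  show ?thesis
  proof (rule leibniz_rule_vector_derivative[where U = UNIV])
    fix s y
    show "((\<lambda>s. W y * m s y * exp (- \<i> * complex_of_real (p s \<bullet> y))) has_vector_derivative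
        W y * (m' s y + m s y * (- \<i> * complex_of_real (p' s \<bullet> y))) * exp (- \<i> * complex_of_real (p s \<bullet> y))) (at s within UNIV)"
      using has_vector_derivative_mult_right[OF has_vector_derivative_mult[OF m[where s = s and y = y]
        e[where s = s and y = y]], of "W y"]
      by (simp add: algebra_simps)
  next
    fix s
    show "(\<lambda>y. W y * m s y * exp (- \<i> * complex_of_real (p s \<bullet> y))) integrable_on cbox a b"
      by (intro integrable_continuous continuous_intros W my)
  next
    show "continuous_on ?X (\<lambda>(s, y). W y * (m' s y + m s y * (- \<i> * complex_of_real (p' s \<bullet> y))) *
        exp (- \<i> * complex_of_real (p s \<bullet> y)))"
      using m_cont m'_cont unfolding case_prod_unfold by (intro continuous_intros W2 p2)
  qed auto
qed

section \<open>Rotations and cylindrical coordinates\<close>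

lemma bounded_bilinear_matrix_vector_mult:
  "bounded_bilinear (\<lambda>(A :: real^'n^'m) (x :: real^'n). A *v x)"
  unfolding bilinear_conv_bounded_bilinear[symmetric] bilinear_def
  by (auto intro!: linearI simp: matrix_vector_mult_add_rdistrib matrix_vector_right_distrib
      matrix_vector_mult_scaleR scaleR_matrix_vector_assoc)

text \<open>Since \<open>R\<close> times its transpose is the identity,
  \<open>R' x = R (R^T R' x) = R (\<omega> \<times> x)\<close>; the rest is the product rule. A
  moving \<open>w\<close> is allowed so that the second derivative follows from the same
  lemma.\<close>

lemma has_vector_derivative_rotation:
  assumes R: "C_k (Suc n) R" "\<And>t. rotation_matrix (R t)" and \<omega>: "angular_velocity R \<omega>"
    and w: "(w has_vector_derivative w') (at t)"
  shows "((\<lambda>s. R s *v w s) has_vector_derivative R t *v (cross3 (\<omega> t) (w t) + w')) (at t)"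
proof -
  let ?R' = "vector_derivative R (at t)"
  have "R t ** (transpose (R t) ** ?R') = ?R'"
    using R(2)[of t] by (simp add: rotation_matrix_def orthogonal_matrix_def matrix_mul_assoc)
  then have "?R' *v x = R t *v cross3 (\<omega> t) x" for x
    using \<omega> by (metis angular_velocity_def matrix_vector_mul_assoc)
  moreover have "(R has_vector_derivative ?R') (at t)"
    using R(1) by (simp add: vector_derivative_works)
  ultimately show ?thesis
    using bounded_bilinear.has_vector_derivative[OF bounded_bilinear_matrix_vector_mult _ w, of R ?R']
    by (simp add: matrix_vector_right_distrib add.commute)
qed

lemma C_k_differentiable:
  assumes "C_k (Suc n) f"
  shows "(f has_vector_derivative vector_derivative f (at t)) (at t)"
  using assms by (simp add: vector_derivative_works)

lemma C_k_continuous: "C_k n f \<Longrightarrow> continuous_on UNIV f"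
  by (cases n) (auto intro!: continuous_at_imp_continuous_on differentiable_imp_continuous_within)

text \<open>Radius and angle are only assumed continuous, so their differentiability at
  \<open>t\<close> comes first. The radius is the square root of a function positive at
  \<open>t\<close>, and the angle is treated locally. The coefficients then follow from uniqueness
  of derivatives, component by component.\<close>

lemma cylindrical_coords_derivative:
  assumes cyl: "cylindrical_coords \<omega> \<alpha> v \<phi> \<omega>3" and \<omega>: "(\<omega> has_vector_derivative \<omega>') (at t)"
    and \<alpha>: "\<alpha> t \<noteq> 0"
  shows "\<omega>' = deriv \<alpha> t *\<^sub>R append3 (v t) 0 + (\<alpha> t * deriv \<phi> t) *\<^sub>R append3 (perp (v t)) 0
    + deriv \<omega>3 t *\<^sub>R axis 3 1"
proof -
  have \<alpha>_cont: "continuous_on UNIV \<alpha>" and \<phi>_cont: "continuous_on UNIV \<phi>" and nn: "\<And>s. 0 \<le> \<alpha> s"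
    and v: "\<And>s. v s = vector [cos (\<phi> s), sin (\<phi> s)]"
    and eq: "\<And>s. \<omega> s = vector [\<alpha> s * v s $ 1, \<alpha> s * v s $ 2, \<omega>3 s]"
    using cyl by (auto simp: cylindrical_coords_def)
  have comp: "((\<lambda>s. \<omega> s $ i) has_real_derivative \<omega>' $ i) (at t)" for i
    using bounded_linear.has_vector_derivative[OF bounded_linear_vec_nth \<omega>]
    by (simp add: has_real_derivative_iff_has_vector_derivative)
  have \<omega>12: "\<omega> s $ 1 = \<alpha> s * cos (\<phi> s)" "\<omega> s $ 2 = \<alpha> s * sin (\<phi> s)" "\<omega> s $ 3 = \<omega>3 s" for s
    by (simp_all add: eq v)
  have d3: "(\<omega>3 has_real_derivative \<omega>' $ 3) (at t)"
    using comp[of 3] by (simp add: \<omega>12)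
  have \<alpha>_eq: "\<alpha> s = sqrt ((\<omega> s $ 1)\<^sup>2 + (\<omega> s $ 2)\<^sup>2)" for s
    using nn[of s] by (simp add: \<omega>12 power_mult_distrib flip: distrib_left)
  have "(\<omega> t $ 1)\<^sup>2 + (\<omega> t $ 2)\<^sup>2 > 0"
    using \<alpha> \<alpha>_eq[of t] by (metis add_nonneg_nonneg order_le_less real_sqrt_zero zero_le_power2)
  moreover have "((\<lambda>s. (\<omega> s $ 1)\<^sup>2 + (\<omega> s $ 2)\<^sup>2) has_real_derivative
      2 * \<omega>' $ 1 * \<omega> t $ 1 + 2 * \<omega>' $ 2 * \<omega> t $ 2) (at t)"
    by (rule derivative_eq_intros comp refl | simp)+
  ultimately have "\<exists>D. ((\<lambda>s. sqrt ((\<omega> s $ 1)\<^sup>2 + (\<omega> s $ 2)\<^sup>2)) has_real_derivative D) (at t)"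
    by (intro exI) (rule DERIV_chain2[OF DERIV_real_sqrt])
  then have d\<alpha>: "(\<alpha> has_real_derivative deriv \<alpha> t) (at t)"
    unfolding \<alpha>_eq[symmetric] using DERIV_imp_deriv by metis
  text \<open>Near \<open>t\<close> the angle is recovered from \<open>v\<close> by \<open>arcsin\<close>.\<close>
  define g where "g s = \<phi> t + arcsin ((\<omega> s $ 2 * cos (\<phi> t) - \<omega> s $ 1 * sin (\<phi> t)) / \<alpha> s)" for s
  \<comment> \<open>At \<open>s = t\<close> the argument of \<open>arcsin\<close> is 0, in the
    interior of its domain.\<close>
  have "\<exists>D. (g has_real_derivative D) (at t)"
    unfolding g_def
    by (intro exI) (rule derivative_eq_intros comp d\<alpha> refl | simp add: \<alpha> \<omega>12)+
  then obtain D where D: "(g has_real_derivative D) (at t)"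
    by blast
  \<comment> \<open>The quotient in \<open>g\<close> is the sine of
    \<open>\<phi> s - \<phi> t\<close> wherever \<open>\<alpha> s\<close> is nonzero. Continuity of
    \<open>\<phi>\<close> keeps this difference in the range where \<open>arcsin\<close> inverts the
    sine.\<close>
  have ev: "\<forall>\<^sub>F s in nhds t. \<phi> s = g s"
  proof -
    have c\<phi>: "isCont \<phi> t" and c\<alpha>: "isCont \<alpha> t"
      using \<phi>_cont \<alpha>_cont by (auto simp: continuous_on_eq_continuous_at)
    have "\<forall>\<^sub>F s in nhds t. dist (\<phi> s) (\<phi> t) < pi / 2"
      using tendstoD[OF c\<phi>[unfolded continuous_at], of "pi / 2"]
      by (simp add: eventually_nhds_conv_at)
    moreover have "\<forall>\<^sub>F s in nhds t. \<alpha> s \<noteq> 0"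
      using tendsto_imp_eventually_ne[OF c\<alpha>[unfolded continuous_at] \<alpha>] \<alpha>
      by (simp add: eventually_nhds_conv_at)
    ultimately show ?thesis
    proof eventually_elim
      case (elim s)
      have "(\<omega> s $ 2 * cos (\<phi> t) - \<omega> s $ 1 * sin (\<phi> t)) / \<alpha> s = sin (\<phi> s - \<phi> t)"
        using elim(2) by (simp add: \<omega>12 sin_diff field_simps)
      moreover have "arcsin (sin (\<phi> s - \<phi> t)) = \<phi> s - \<phi> t"
        using elim(1) by (intro arcsin_sin) (auto simp: dist_real_def abs_if split: if_splits)
      ultimately show ?case
        by (simp add: g_def)
    qed
  qed
  have "(\<phi> has_real_derivative D) (at t)"
    using D DERIV_cong_ev[OF refl ev refl, of D] by simp
  then have d\<phi>: "(\<phi> has_real_derivative deriv \<phi> t) (at t)"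
    using DERIV_imp_deriv by metis
  have "((\<lambda>s. \<omega> s $ 1) has_real_derivative deriv \<alpha> t * cos (\<phi> t) - \<alpha> t * sin (\<phi> t) * deriv \<phi> t) (at t)"
    unfolding \<omega>12 by (rule derivative_eq_intros d\<alpha> d\<phi> refl | simp)+
  moreover have "((\<lambda>s. \<omega> s $ 2) has_real_derivative deriv \<alpha> t * sin (\<phi> t) + \<alpha> t * cos (\<phi> t) * deriv \<phi> t) (at t)"
    unfolding \<omega>12 by (rule derivative_eq_intros d\<alpha> d\<phi> refl | simp)+
  ultimately have "\<omega>' $ 1 = deriv \<alpha> t * cos (\<phi> t) - \<alpha> t * sin (\<phi> t) * deriv \<phi> t"
    "\<omega>' $ 2 = deriv \<alpha> t * sin (\<phi> t) + \<alpha> t * cos (\<phi> t) * deriv \<phi> t"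
    using comp DERIV_unique by blast+
  moreover have "\<omega>' $ 3 = deriv \<omega>3 t"
    using d3 DERIV_imp_deriv by metis
  ultimately show ?thesis
    by (simp add: vec_eq_iff forall_3 perp_def v axis_def)
qed

text \<open>The three vectors form a positively oriented orthonormal frame, in which the angular
  velocity and its derivative are expanded below.\<close>

lemma cross3_append3_frame:
  assumes "norm x = 1"
  shows "cross3 (append3 x 0) (append3 (perp x) 0) = axis 3 1"
    "cross3 (append3 (perp x) 0) (axis 3 1) = append3 x 0"
    "cross3 (axis 3 1) (append3 x 0) = append3 (perp x) 0"
  using assms
  by (simp_all add: cross3_def vec_eq_iff forall_3 perp_def axis_def norm_eq_1 inner_vec_def sum_2)

section \<open>The identity\<close>

theorem proposition3p8:
  fixes u :: "real^3 \<Rightarrow> real" and T :: "real \<Rightarrow> real^3" and R :: "real \<Rightarrow> real^3^3"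
    and \<omega> :: "real \<Rightarrow> real^3" and \<alpha> \<phi> \<omega>3 \<sigma> :: "real \<Rightarrow> real" and v :: "real \<Rightarrow> real^2"
    and J :: "real \<Rightarrow> real^2 \<Rightarrow> complex"
  assumes u: "u \<in> Cc_plus"
    and T: "continuous_on UNIV T"
    and R: "C_k 4 R" "\<And>t. rotation_matrix (R t)"
    and \<omega>: "C_k 3 \<omega>" "angular_velocity R \<omega>"
    and cyl: "cylindrical_coords \<omega> \<alpha> v \<phi> \<omega>3"
    and \<sigma>: "\<sigma> = deriv \<phi>"
    and J: "J = reduced_attenuation u T R"
  shows "\<forall>t. \<alpha> t \<noteq> 0 \<and> \<sigma> t \<noteq> - \<omega>3 t \<longrightarrow>
    (\<forall>\<mu>. coeff_A0 J t (v t) (\<omega>3 t) (deriv \<omega>3 t) (\<sigma> t) \<mu>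
        + (\<alpha> t)\<^sup>2 *\<^sub>R coeff_A02 J t (v t) (\<omega>3 t) (\<sigma> t) \<mu>
        + (\<mu> * (deriv \<alpha> t / \<alpha> t)) *\<^sub>R coeff_A1 J t (v t) (\<omega>3 t) (\<sigma> t) \<mu> = 0)"
proof (intro allI impI)
  fix t \<mu> assume "\<alpha> t \<noteq> 0 \<and> \<sigma> t \<noteq> - \<omega>3 t"
  then have \<alpha>: "\<alpha> t \<noteq> 0"
    by simp
  obtain a b W where W: "continuous_on (cbox a b) W" and
    "\<And>t k. reduced_attenuation u T R t k =
      integral (cbox a b) (\<lambda>y. W y * exp (- \<i> * complex_of_real ((R t *v append3 k 0) \<bullet> y)))"
    by (rule reduced_attenuation_cbox[where R = R and T = T, OF u R(2)], rule that)
  note JW = this(2)[folded J]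
  define l where "l s z y = - \<i> * complex_of_real ((R s *v z) \<bullet> y)" for s z y
  define I where "I g = integral (cbox a b) g" for g :: "real^3 \<Rightarrow> complex"
  have kd: "kderiv J s ws k = I (\<lambda>y. W y * (\<Prod>w\<leftarrow>ws. l s (append3 w 0) y) * exp (l s (append3 k 0) y))" for s ws k
  proof -
    have "linear (\<lambda>k. R s *v append3 k 0)"
      using linear_compose[OF bounded_linear.linear[OF bounded_linear_append3] matrix_vector_mul_linear]
      by (simp add: comp_def)
    from kderiv_fourier_cbox[where f = J and t = s and ws = ws, OF W this JW]
    show ?thesis
      by (simp add: fweight_def comp_def I_def l_def)
  qed

  define w where "w s = vector_derivative \<omega> (at s)" for s
  have C: "C_k (Suc 2) \<omega>" "C_k (Suc 3) R"
    using R \<omega> by (simp_all add: numeral_eq_Suc)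
  have d\<omega>: "(\<omega> has_vector_derivative w s) (at s)" for s
    unfolding w_def by (rule C_k_differentiable[OF C(1)])
  have "C_k 2 w"
    using C(1) unfolding w_def[abs_def] C_k.simps by blast
  note cont = this[THEN C_k_continuous] C[THEN C_k_continuous]
  \<comment> \<open>For fixed \<open>z\<close> the first and second time derivatives of
    \<open>R z\<close> are \<open>R (X z)\<close> and \<open>R (Y z)\<close>; the last term of
    \<open>Y\<close> comes from differentiating \<open>\<omega>\<close>.\<close>
  define X where "X s z = cross3 (\<omega> s) z" for s z
  define Y where "Y s z = cross3 (\<omega> s) (cross3 (\<omega> s) z) + cross3 (w s) z" for s z
  have dR: "((\<lambda>s. R s *v z) has_vector_derivative R s *v X s z) (at s)" for s z
    using has_vector_derivative_rotation[OF C(2) R(2) \<omega>(2) has_vector_derivative_const]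
    by (simp add: X_def)
  have ddR: "((\<lambda>s. R s *v X s z) has_vector_derivative R s *v Y s z) (at s)" for s z
  proof -
    have "((\<lambda>s. cross3 (\<omega> s) z) has_vector_derivative cross3 (w s) z) (at s)"
      by (rule bounded_linear.has_vector_derivative[OF _ d\<omega>])
        (auto simp: linear_conv_bounded_linear[symmetric] cross_add_left cross_mult_left intro!: linearI)
    from has_vector_derivative_rotation[OF C(2) R(2) \<omega>(2) this]
    show ?thesis
      by (simp add: X_def Y_def)
  qed
  have contX: "continuous_on UNIV (\<lambda>s. R s *v X s z)" and contR: "continuous_on UNIV (\<lambda>s. R s *v z)" for z
    using dR ddR by (blast intro: continuous_at_imp_continuous_on has_vector_derivative_continuous)+
  have contY: "continuous_on UNIV (\<lambda>s. R s *v Y s z)" for z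
    unfolding Y_def
    by (intro bounded_bilinear.continuous_on[OF bounded_bilinear_matrix_vector_mult] continuous_intros cont
      continuous_on_cross)
  have bl: "bounded_linear (\<lambda>x. - \<i> * complex_of_real (x \<bullet> y))" for y :: "real^3"
    by (intro bounded_linear_const_mult bounded_linear_compose[OF bounded_linear_of_real] bounded_linear_inner_left)
  have dl: "((\<lambda>s. l s z y) has_vector_derivative l s (X s z) y) (at s)"
      "((\<lambda>s. l s (X s z) y) has_vector_derivative l s (Y s z) y) (at s)" for s z y
    unfolding l_def by (rule bounded_linear.has_vector_derivative[OF bl dR])
      (rule bounded_linear.has_vector_derivative[OF bl ddR])
  have cl: "continuous_on (UNIV \<times> cbox a b) (\<lambda>x. l (fst x) z (snd x))"
      "continuous_on (UNIV \<times> cbox a b) (\<lambda>x. l (fst x) (X (fst x) z) (snd x))"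
      "continuous_on (UNIV \<times> cbox a b) (\<lambda>x. l (fst x) (Y (fst x) z) (snd x))" for z
    unfolding l_def
    by (intro continuous_intros continuous_on_compose2[OF contR] continuous_on_compose2[OF contX]
      continuous_on_compose2[OF contY]; auto)+
  \<comment> \<open>The Leibniz rule for the frequency path \<open>R s *v z\<close>, whose velocity
    is \<open>R s *v X s z\<close>.\<close>
  have dI: "((\<lambda>s. I (\<lambda>y. W y * m s y * exp (l s z y))) has_vector_derivative
      I (\<lambda>y. W y * (m' t y + m t y * l t (X t z) y) * exp (l t z y))) (at t)"
    if "\<And>s y. ((\<lambda>s. m s y) has_vector_derivative m' s y) (at s)"
      "continuous_on (UNIV \<times> cbox a b) (\<lambda>(s, y). m s y)"
      "continuous_on (UNIV \<times> cbox a b) (\<lambda>(s, y). m' s y)" for m m' z t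
    unfolding I_def l_def
    using has_vector_derivative_fourier_cbox[where t = t, OF W that dR[where z = z] contX[where z = z]]
    by (simp only: l_def)

  \<comment> \<open>These vectors are frozen at time \<open>t\<close>: the time derivatives in the
    claim hold the base point and the directions fixed, so only \<open>R\<close> varies with
    \<open>s\<close>.\<close>
  define e1 e2 where "e1 = append3 (v t) 0" and "e2 = append3 (perp (v t)) 0"
  let ?e3 = "axis 3 1 :: real^3"
  have smult: "append3 (c *\<^sub>R k) 0 = c *\<^sub>R append3 k 0" and add: "append3 (k + k') 0 = append3 k 0 + append3 k' 0"
    and diff: "append3 (k - k') 0 = append3 k 0 - append3 k' 0" for c k k'
    by (simp_all add: vec_eq_iff forall_3)
  define \<kappa> where "\<kappa> = \<mu> *\<^sub>R v t"
  define z where "z = append3 \<kappa> 0"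
  have z: "z = \<mu> *\<^sub>R e1"
    by (simp add: z_def \<kappa>_def e1_def smult)
  define E where "E y = exp (l t z y)" for y
  have dt2: "dt_D J t \<kappa> [perp (v t), perp (v t)] =
      I (\<lambda>y. W y * (2 * l t (X t e2) y * l t e2 y + l t e2 y * l t e2 y * l t (X t z) y) * E y)"
  proof -
    have "((\<lambda>s. I (\<lambda>y. W y * (l s e2 y * l s e2 y) * exp (l s z y))) has_vector_derivative
        I (\<lambda>y. W y * (2 * l t (X t e2) y * l t e2 y + l t e2 y * l t e2 y * l t (X t z) y) * exp (l t z y))) (at t)"
    proof (rule dI[where m' = "\<lambda>s y. 2 * l s (X s e2) y * l s e2 y"])
      show "((\<lambda>s. l s e2 y * l s e2 y) has_vector_derivative 2 * l s (X s e2) y * l s e2 y) (at s)" for s y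
        using has_vector_derivative_mult[OF dl(1)[of e2 y s] dl(1)[of e2 y s]] by (simp add: mult_ac)
    qed (simp_all add: case_prod_unfold continuous_intros cl)
    then show ?thesis
      unfolding dt_D_def kd z_def[symmetric] E_def by (simp add: vector_derivative_at flip: e2_def)
  qed
  \<comment> \<open>Proved for every \<open>s\<close>, since the second time derivative
    differentiates this expression as a function of \<open>s\<close>.\<close>
  have dt1: "((\<lambda>s. I (\<lambda>y. W y * l s e2 y * exp (l s z y))) has_vector_derivative
      I (\<lambda>y. W y * (l s (X s e2) y + l s e2 y * l s (X s z) y) * exp (l s z y))) (at s)" for s
    by (rule dI[where m = "\<lambda>s y. l s e2 y" and m' = "\<lambda>s y. l s (X s e2) y"])
      (auto simp: case_prod_unfold dl cl)
  have dt1': "dt_D J s \<kappa> [perp (v t)] =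
      I (\<lambda>y. W y * (l s (X s e2) y + l s e2 y * l s (X s z) y) * exp (l s z y))" for s
    using vector_derivative_at[OF dt1, of s]
    unfolding dt_D_def kd z_def[symmetric] by (simp flip: e2_def)
  have dtt1: "dtt_D J t \<kappa> [perp (v t)] =
      I (\<lambda>y. W y * ((l t (Y t e2) y + (l t (X t e2) y * l t (X t z) y + l t e2 y * l t (Y t z) y))
        + (l t (X t e2) y + l t e2 y * l t (X t z) y) * l t (X t z) y) * E y)"
  proof -
    have "((\<lambda>s. I (\<lambda>y. W y * (l s (X s e2) y + l s e2 y * l s (X s z) y) * exp (l s z y))) has_vector_derivative
       I (\<lambda>y. W y * ((l t (Y t e2) y + (l t (X t e2) y * l t (X t z) y + l t e2 y * l t (Y t z) y))
        + (l t (X t e2) y + l t e2 y * l t (X t z) y) * l t (X t z) y) * exp (l t z y))) (at t)"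
    proof (rule dI[where m' = "\<lambda>t y. l t (Y t e2) y + (l t (X t e2) y * l t (X t z) y + l t e2 y * l t (Y t z) y)"])
      show "((\<lambda>s. l s (X s e2) y + l s e2 y * l s (X s z) y) has_vector_derivative
          l s (Y s e2) y + (l s (X s e2) y * l s (X s z) y + l s e2 y * l s (Y s z) y)) (at s)" for s y
        using has_vector_derivative_add[OF dl(2) has_vector_derivative_mult[OF dl(1) dl(2)]]
        by (simp add: add.commute)
    qed (simp_all add: case_prod_unfold continuous_intros cl)
    then show ?thesis
      unfolding dtt_D_def dt1' E_def by (simp add: vector_derivative_at)
  qed

  have v1: "norm (v t) = 1"
    using cyl unfolding cylindrical_coords_def by (metis mem_sphere_0)
  have \<omega>t: "\<omega> t = \<alpha> t *\<^sub>R e1 + \<omega>3 t *\<^sub>R ?e3"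
  proof -
    have "\<omega> t = vector [\<alpha> t * v t $ 1, \<alpha> t * v t $ 2, \<omega>3 t]"
      using cyl unfolding cylindrical_coords_def by blast
    then show ?thesis
      by (simp only: vec_eq_iff forall_3) (simp add: e1_def axis_def)
  qed
  have wt: "w t = deriv \<alpha> t *\<^sub>R e1 + (\<alpha> t * \<sigma> t) *\<^sub>R e2 + deriv \<omega>3 t *\<^sub>R ?e3"
    using cylindrical_coords_derivative[OF cyl d\<omega> \<alpha>] by (simp add: e1_def e2_def \<sigma>)
  note frame = cross3_append3_frame[OF v1, folded e1_def e2_def]
  have frame': "cross3 e2 e1 = - ?e3" "cross3 ?e3 e2 = - e1" "cross3 e1 ?e3 = - e2"
    using frame cross_skew by metis+
  note bil = cross_add_left cross_add_right cross_mult_left cross_mult_right cross_minus_left cross_minus_right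
    Cross3.right_diff_distrib Cross3.left_diff_distrib cross_refl
  \<comment> \<open>Expanding in the frame leaves \<open>l t e1 y\<close>, \<open>l t e2 y\<close>
    and \<open>l t ?e3 y\<close> as the only unknowns in the integrands.\<close>
  have Xz: "X t z = (\<mu> * \<omega>3 t) *\<^sub>R e2"
    and X2: "X t e2 = \<alpha> t *\<^sub>R ?e3 - \<omega>3 t *\<^sub>R e1"
    by (simp_all add: X_def \<omega>t z bil frame frame' algebra_simps)
  have Yz: "Y t z = (\<mu> * (\<alpha> t * \<omega>3 t - \<alpha> t * \<sigma> t)) *\<^sub>R ?e3 - (\<mu> * (\<omega>3 t)\<^sup>2) *\<^sub>R e1 + (\<mu> * deriv \<omega>3 t) *\<^sub>R e2"
    and Y2: "Y t e2 = deriv \<alpha> t *\<^sub>R ?e3 - ((\<omega>3 t)\<^sup>2 + (\<alpha> t)\<^sup>2) *\<^sub>R e2 - deriv \<omega>3 t *\<^sub>R e1"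
    by (simp_all add: Y_def \<omega>t wt z bil frame frame' algebra_simps power2_eq_square)
  have llin: "l t (c *\<^sub>R x) y = complex_of_real c * l t x y" "l t (x + x') y = l t x y + l t x' y"
    "l t (x - x') y = l t x y - l t x' y" for c x x' y
    by (simp_all add: l_def matrix_vector_right_distrib matrix_vector_mult_diff_distrib matrix_vector_mult_scaleR
      inner_add_left inner_diff_left algebra_simps)
  \<comment> \<open>Writing \<open>\<alpha>'\<close> as \<open>k * \<alpha>\<close> removes the
    division, so that the final identity is polynomial.\<close>
  define k where "k = deriv \<alpha> t / \<alpha> t"
  have k: "deriv \<alpha> t = k * \<alpha> t"
    using \<alpha> by (simp add: k_def)
  have lc: "continuous_on (cbox a b) (\<lambda>y. l t x y)" for x
    unfolding l_def by (intro continuous_intros)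
  have hi: "((\<lambda>y. W y * f y * E y) has_integral I (\<lambda>y. W y * f y * E y)) (cbox a b)"
    if "continuous_on (cbox a b) f" for f
    unfolding I_def E_def
    by (intro integrable_integral integrable_continuous continuous_intros W that lc)
  let ?c0 = "1/4 * \<mu> * (\<omega>3 t + \<sigma> t)" and ?c02 = "1/2 * \<mu> * (\<omega>3 t + \<sigma> t)" and ?c1 = "1/2 * (\<omega>3 t + \<sigma> t)"
  let ?z2 = "(\<omega>3 t * \<sigma> t) *\<^sub>R e1 - deriv \<omega>3 t *\<^sub>R e2" and ?z1 = "(\<omega>3 t)\<^sup>2 *\<^sub>R e2 + deriv \<omega>3 t *\<^sub>R e1"
  let ?d3 = "\<lambda>y. l t e2 y * l t e2 y * l t e2 y"
  let ?dt2 = "\<lambda>y. 2 * l t (X t e2) y * l t e2 y + l t e2 y * l t e2 y * l t (X t z) y"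
  let ?dt1 = "\<lambda>y. l t (X t e2) y + l t e2 y * l t (X t z) y"
  let ?dtt1 = "\<lambda>y. (l t (Y t e2) y + (l t (X t e2) y * l t (X t z) y + l t e2 y * l t (Y t z) y))
        + (l t (X t e2) y + l t e2 y * l t (X t z) y) * l t (X t z) y"
  let ?P = "\<lambda>f. I (\<lambda>y. W y * f y * E y)"
  \<comment> \<open>The left side of the claim as a linear function of its nine derivative terms. It
    is applied to the integrands and to the integrals alike, and linearity of integration connects
    the two.\<close>
  let ?S = "\<lambda>d3 d2 d1 dt2 dtt1 d1b d2bb d1a dt1. ?c0 *\<^sub>R ((\<mu>\<^sup>2 * \<omega>3 t * (\<omega>3 t - \<sigma> t)) *\<^sub>R d3 + (2 * \<mu>) *\<^sub>R d2 + 2 *\<^sub>R d1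
      - (\<mu> * (3 * \<omega>3 t - \<sigma> t)) *\<^sub>R dt2 + 2 *\<^sub>R dtt1)
    + (\<alpha> t)\<^sup>2 *\<^sub>R (?c02 *\<^sub>R d1b) + (\<mu> * k) *\<^sub>R (?c1 *\<^sub>R ((\<mu> * \<omega>3 t) *\<^sub>R d2bb - \<omega>3 t *\<^sub>R d1a - dt1)) :: complex"
  have kdt: "kderiv J t ws \<kappa> = ?P (\<lambda>y. \<Prod>w\<leftarrow>ws. l t (append3 w 0) y)" for ws
    by (simp add: kd E_def z_def)
  have "((\<lambda>y. ?S (W y * ?d3 y * E y) (W y * (l t e2 y * l t ?z2 y) * E y) (W y * l t ?z1 y * E y)
      (W y * ?dt2 y * E y) (W y * ?dtt1 y * E y) (W y * l t e2 y * E y) (W y * (l t e2 y * l t e2 y) * E y)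
      (W y * l t e1 y * E y) (W y * ?dt1 y * E y)) has_integral
    ?S (?P ?d3) (?P (\<lambda>y. l t e2 y * l t ?z2 y)) (?P (l t ?z1)) (?P ?dt2) (?P ?dtt1) (?P (l t e2))
      (?P (\<lambda>y. l t e2 y * l t e2 y)) (?P (l t e1)) (?P ?dt1)) (cbox a b)"
    by (intro has_integral_add has_integral_diff has_integral_cmul hi continuous_intros lc)
  \<comment> \<open>In the bracket of \<open>coeff_A0\<close> all quadratic and cubic terms cancel,
    leaving \<open>2 * k * \<alpha> * l(e3) - 2 * \<alpha>^2 * l(e2)\<close>. The second summand
    cancels against \<open>coeff_A02\<close>, and the first against \<open>coeff_A1\<close>, whose
    bracket reduces to \<open>- \<alpha> * l(e3)\<close>.\<close>
  moreover have "?S (W y * ?d3 y * E y) (W y * (l t e2 y * l t ?z2 y) * E y) (W y * l t ?z1 y * E y)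
      (W y * ?dt2 y * E y) (W y * ?dtt1 y * E y) (W y * l t e2 y * E y) (W y * (l t e2 y * l t e2 y) * E y)
      (W y * l t e1 y * E y) (W y * ?dt1 y * E y) = 0" for y
    unfolding Xz X2 Yz Y2 llin k
    by (simp add: scaleR_conv_of_real power2_eq_square) (simp add: field_simps)
  ultimately have "?S (?P ?d3) (?P (\<lambda>y. l t e2 y * l t ?z2 y)) (?P (l t ?z1)) (?P ?dt2) (?P ?dtt1) (?P (l t e2))
      (?P (\<lambda>y. l t e2 y * l t e2 y)) (?P (l t e1)) (?P ?dt1) = 0"
    by (simp only: has_integral_0_eq)
  moreover have "D J t \<kappa> [perp (v t), perp (v t), perp (v t)] = ?P ?d3"
    "D J t \<kappa> [perp (v t), (\<omega>3 t * \<sigma> t) *\<^sub>R v t - deriv \<omega>3 t *\<^sub>R perp (v t)] = ?P (\<lambda>y. l t e2 y * l t ?z2 y)"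
    "D J t \<kappa> [(\<omega>3 t)\<^sup>2 *\<^sub>R perp (v t) + deriv \<omega>3 t *\<^sub>R v t] = ?P (l t ?z1)"
    "D J t \<kappa> [perp (v t)] = ?P (l t e2)" "D J t \<kappa> [v t] = ?P (l t e1)"
    "D J t \<kappa> [perp (v t), perp (v t)] = ?P (\<lambda>y. l t e2 y * l t e2 y)"
    unfolding kdt by (simp_all add: smult add diff mult.assoc flip: e1_def e2_def)
  ultimately show "coeff_A0 J t (v t) (\<omega>3 t) (deriv \<omega>3 t) (\<sigma> t) \<mu>
      + (\<alpha> t)\<^sup>2 *\<^sub>R coeff_A02 J t (v t) (\<omega>3 t) (\<sigma> t) \<mu>
      + (\<mu> * (deriv \<alpha> t / \<alpha> t)) *\<^sub>R coeff_A1 J t (v t) (\<omega>3 t) (\<sigma> t) \<mu> = 0"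
    by (simp only: coeff_A0_def coeff_A02_def coeff_A1_def \<kappa>_def[symmetric] dt2 dtt1 dt1' k_def[symmetric] E_def)
qed

end
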